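(* Let $R$ be a left Noetherian ring and let $n\geq 1$. If $S$ is a subring of the full matrix ring $M_{n}(R)$ such that $\{rI\mid r\in R\}\subseteq S$, then $S\cap U(M_{n}(R))=U(S)$.
   Context: All rings are associative with identity (not necessarily commutative), and every subring contains the identity of the larger ring. $U(\cdot)$ denotes the group of units of a ring, $M_n(R)$ the ring of $n\times n$ matrices over $R$, and $I$ the $n\times n$ identity matrix. *)

theory Defs
  imports "Jordan_Normal_Form.Matrix" "HOL-Algebra.Subrings"
begin

definition left_ideal :: "'a set \<Rightarrow> ('a, 'b) ring_scheme \<Rightarrow> bool" where
  "left_ideal J R \<longleftrightarrow> additive_subgroup J R \<and> (\<forall>r \<in> carrier R. \<forall>x \<in> J. r \<otimes>\<^bsub>R\<^esub> x \<in> J)"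

text \<open>The library's \<open>noetherian_ring\<close> concerns two-sided ideals and is therefore weaker than what
  is needed for a noncommutative ring.\<close>

locale left_noetherian_ring = ring R for R (structure) +
  assumes left_ideal_chain_stabilizes:
    "\<And>J :: nat \<Rightarrow> 'a set. (\<And>k. left_ideal (J k) R) \<Longrightarrow> (\<And>k. J k \<subseteq> J (Suc k)) \<Longrightarrow>
       \<exists>N. \<forall>k \<ge> N. J k = J N"

text \<open>Here the coefficients come from a ring given by a carrier, so the matrix operations of
  \<open>Jordan_Normal_Form.Matrix\<close>, which belong to type-class coefficients, do not apply; only its
  type of matrices (with indices starting at 0) is used.\<close>

definition scalar_matrix :: "('a, 'b) ring_scheme \<Rightarrow> nat \<Rightarrow> 'a \<Rightarrow> 'a mat" where
  "scalar_matrix R n r = mat n n (\<lambda>(i, j). if i = j then r else \<zero>\<^bsub>R\<^esub>)"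

definition matrix_ring :: "('a, 'b) ring_scheme \<Rightarrow> nat \<Rightarrow> 'a mat ring" where
  "matrix_ring R n = \<lparr>
     carrier = {A \<in> carrier_mat n n. \<forall>i < n. \<forall>j < n. A $$ (i, j) \<in> carrier R},
     mult = (\<lambda>A B. mat n n (\<lambda>(i, j). \<Oplus>\<^bsub>R\<^esub>k \<in> {..<n}. A $$ (i, k) \<otimes>\<^bsub>R\<^esub> B $$ (k, j))),
     one = scalar_matrix R n \<one>\<^bsub>R\<^esub>,
     zero = mat n n (\<lambda>_. \<zero>\<^bsub>R\<^esub>),
     add = (\<lambda>A B. mat n n (\<lambda>(i, j). A $$ (i, j) \<oplus>\<^bsub>R\<^esub> B $$ (i, j)))\<rparr>"

end

theory Submission
  imports Defs
begin

text \<open>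
  Let \<open>A \<in> S\<close> be invertible in \<open>M\<^sub>n(R)\<close> with inverse \<open>B\<close>; the point is that \<open>B \<in> S\<close>.  Each
  \<open>S B\<^sup>k\<close> is an additive subgroup of \<open>M\<^sub>n(R)\<close>, and it is closed under left multiplication by
  scalars since \<open>S\<close> contains the scalar matrices.  Moreover \<open>s B\<^sup>k = (s A) B\<^sup>k\<^sup>+\<^sup>1\<close>, so
  \<open>S \<subseteq> S B \<subseteq> S B\<^sup>2 \<subseteq> \<dots>\<close> is an ascending chain of left \<open>R\<close>-submodules of \<open>M\<^sub>n(R)\<close>
  (\<open>translates_by_inverse_powers_ascending\<close>).  As a left module \<open>M\<^sub>n(R)\<close> is free of rank
  \<open>n\<^sup>2\<close>, hence Noetherian (\<open>matrix_submodule_chain_stabilizes\<close>), and the chain becomes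
  stationary.  Then \<open>B\<^sup>N\<^sup>+\<^sup>1 = s B\<^sup>N\<close> for some \<open>N\<close> and some \<open>s \<in> S\<close>, and cancelling \<open>B\<^sup>N\<close>
  gives \<open>B = s\<close> (\<open>inv_mem_submonoid_if_translates_stabilize\<close>).

  That a finite free module satisfies the ascending chain condition is proved with leading
  coefficients.  For a submodule \<open>V\<close> and a coordinate \<open>e\<close>, the \<open>e\<close>-th coordinates of those
  elements of \<open>V\<close> whose earlier coordinates vanish form a left ideal.  Along a chain of
  submodules these finitely many ideals are all constant from some index on, and nested submodules
  with the same leading ideals are equal: an element of the larger one is
  brought to zero by subtracting elements of the smaller one, one coordinate at a time.
\<close>

section \<open>The ring of square matrices\<close>

lemma matrix_ring_carrier_iff:
  "A \<in> carrier (matrix_ring R n) \<longleftrightarrow>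
     A \<in> carrier_mat n n \<and> (\<forall>i<n. \<forall>j<n. A $$ (i, j) \<in> carrier R)"
  by (simp add: matrix_ring_def)

lemma matrix_ring_entry_closed:
  "\<lbrakk>A \<in> carrier (matrix_ring R n); i < n; j < n\<rbrakk> \<Longrightarrow> A $$ (i, j) \<in> carrier R"
  by (simp add: matrix_ring_carrier_iff)

lemma matrix_ring_eqI:
  assumes "A \<in> carrier (matrix_ring R n)" "B \<in> carrier (matrix_ring R n)"
    and "\<And>i j. i < n \<Longrightarrow> j < n \<Longrightarrow> A $$ (i, j) = B $$ (i, j)"
  shows "A = B"
  using assms by (intro eq_matI) (auto simp: matrix_ring_carrier_iff)

lemma matrix_ring_entries:
  assumes "i < n" "j < n"
  shows "(A \<otimes>\<^bsub>matrix_ring R n\<^esub> B) $$ (i, j) = (\<Oplus>\<^bsub>R\<^esub>k\<in>{..<n}. A $$ (i, k) \<otimes>\<^bsub>R\<^esub> B $$ (k, j))"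
    and "(A \<oplus>\<^bsub>matrix_ring R n\<^esub> B) $$ (i, j) = A $$ (i, j) \<oplus>\<^bsub>R\<^esub> B $$ (i, j)"
    and "\<zero>\<^bsub>matrix_ring R n\<^esub> $$ (i, j) = \<zero>\<^bsub>R\<^esub>"
    and "\<one>\<^bsub>matrix_ring R n\<^esub> $$ (i, j) = (if i = j then \<one>\<^bsub>R\<^esub> else \<zero>\<^bsub>R\<^esub>)"
    and "scalar_matrix R n r $$ (i, j) = (if i = j then r else \<zero>\<^bsub>R\<^esub>)"
  using assms by (simp_all add: matrix_ring_def scalar_matrix_def)

lemma (in abelian_monoid) finsum_swap:
  assumes "finite I" "finite J" "\<And>i j. i \<in> I \<Longrightarrow> j \<in> J \<Longrightarrow> f i j \<in> carrier G"
  shows "(\<Oplus>i\<in>I. \<Oplus>j\<in>J. f i j) = (\<Oplus>j\<in>J. \<Oplus>i\<in>I. f i j)"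
  using assms(1,3)
proof (induction I rule: finite_induct)
  case empty
  show ?case by (simp add: finsum_zero)
next
  case (insert x I)
  have "(\<Oplus>i\<in>insert x I. \<Oplus>j\<in>J. f i j) = (\<Oplus>j\<in>J. f x j) \<oplus> (\<Oplus>j\<in>J. \<Oplus>i\<in>I. f i j)"
    using insert by (subst finsum_insert) (auto intro!: finsum_closed)
  also have "\<dots> = (\<Oplus>j\<in>J. f x j \<oplus> (\<Oplus>i\<in>I. f i j))"
    using insert by (subst finsum_addf) (auto intro!: finsum_closed)
  also have "\<dots> = (\<Oplus>j\<in>J. \<Oplus>i\<in>insert x I. f i j)"
    using insert by (intro finsum_cong') (auto intro!: finsum_closed simp: finsum_insert)
  finally show ?case .
qed

context ring
begin

lemma matrix_ring_mult_closed:
  assumes "A \<in> carrier (matrix_ring R n)" "B \<in> carrier (matrix_ring R n)"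
  shows "A \<otimes>\<^bsub>matrix_ring R n\<^esub> B \<in> carrier (matrix_ring R n)"
  using assms by (auto simp: matrix_ring_def intro!: finsum_closed)

lemma matrix_ring_add_closed:
  assumes "A \<in> carrier (matrix_ring R n)" "B \<in> carrier (matrix_ring R n)"
  shows "A \<oplus>\<^bsub>matrix_ring R n\<^esub> B \<in> carrier (matrix_ring R n)"
  using assms by (auto simp: matrix_ring_def)

lemma scalar_matrix_closed:
  "r \<in> carrier R \<Longrightarrow> scalar_matrix R n r \<in> carrier (matrix_ring R n)"
  by (auto simp: matrix_ring_def scalar_matrix_def)

lemma scalar_matrix_mult_entry:
  assumes "A \<in> carrier (matrix_ring R n)" "r \<in> carrier R" "i < n" "j < n"
  shows "(scalar_matrix R n r \<otimes>\<^bsub>matrix_ring R n\<^esub> A) $$ (i, j) = r \<otimes> A $$ (i, j)"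
proof -
  have "(scalar_matrix R n r \<otimes>\<^bsub>matrix_ring R n\<^esub> A) $$ (i, j)
      = (\<Oplus>k\<in>{..<n}. if i = k then r \<otimes> A $$ (k, j) else \<zero>)"
    using assms
    by (simp only: matrix_ring_entries, intro finsum_cong')
       (auto simp: matrix_ring_entries matrix_ring_entry_closed)
  also have "\<dots> = r \<otimes> A $$ (i, j)"
    using assms finsum_singleton[of i "{..<n}" "\<lambda>k. r \<otimes> A $$ (k, j)"]
    by (auto simp: matrix_ring_entry_closed)
  finally show ?thesis .
qed

lemma matrix_ring_one_eq: "\<one>\<^bsub>matrix_ring R n\<^esub> = scalar_matrix R n \<one>"
  by (simp add: matrix_ring_def)

lemma matrix_ring_r_one:
  assumes "A \<in> carrier (matrix_ring R n)"
  shows "A \<otimes>\<^bsub>matrix_ring R n\<^esub> \<one>\<^bsub>matrix_ring R n\<^esub> = A"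
proof (rule matrix_ring_eqI)
  fix i j assume ij: "i < n" "j < n"
  have "(A \<otimes>\<^bsub>matrix_ring R n\<^esub> \<one>\<^bsub>matrix_ring R n\<^esub>) $$ (i, j)
      = (\<Oplus>k\<in>{..<n}. if j = k then A $$ (i, k) else \<zero>)"
    using assms ij
    by (simp only: matrix_ring_entries, intro finsum_cong')
       (auto simp: matrix_ring_entries matrix_ring_entry_closed)
  also have "\<dots> = A $$ (i, j)"
    using assms ij finsum_singleton[of j "{..<n}" "\<lambda>k. A $$ (i, k)"]
    by (auto simp: matrix_ring_entry_closed)
  finally show "(A \<otimes>\<^bsub>matrix_ring R n\<^esub> \<one>\<^bsub>matrix_ring R n\<^esub>) $$ (i, j) = A $$ (i, j)" .
qed (use assms in \<open>auto simp: matrix_ring_one_eq intro!: matrix_ring_mult_closed scalar_matrix_closed\<close>)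

lemma matrix_ring_m_assoc:
  assumes A: "A \<in> carrier (matrix_ring R n)" and B: "B \<in> carrier (matrix_ring R n)"
    and C: "C \<in> carrier (matrix_ring R n)"
  shows "(A \<otimes>\<^bsub>matrix_ring R n\<^esub> B) \<otimes>\<^bsub>matrix_ring R n\<^esub> C
       = A \<otimes>\<^bsub>matrix_ring R n\<^esub> (B \<otimes>\<^bsub>matrix_ring R n\<^esub> C)"
proof (rule matrix_ring_eqI)
  fix i j assume ij: "i < n" "j < n"
  note mem = A[THEN matrix_ring_entry_closed] B[THEN matrix_ring_entry_closed]
    C[THEN matrix_ring_entry_closed]
  have "((A \<otimes>\<^bsub>matrix_ring R n\<^esub> B) \<otimes>\<^bsub>matrix_ring R n\<^esub> C) $$ (i, j)
      = (\<Oplus>l\<in>{..<n}. (\<Oplus>k\<in>{..<n}. A $$ (i, k) \<otimes> B $$ (k, l)) \<otimes> C $$ (l, j))"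
    using ij mem by (simp only: matrix_ring_entries, intro finsum_cong')
       (auto simp: matrix_ring_entries intro!: finsum_closed)
  also have "\<dots> = (\<Oplus>l\<in>{..<n}. \<Oplus>k\<in>{..<n}. A $$ (i, k) \<otimes> (B $$ (k, l) \<otimes> C $$ (l, j)))"
    using ij mem
    by (intro finsum_cong') (auto simp: finsum_ldistr m_assoc intro!: finsum_closed finsum_cong')
  also have "\<dots> = (\<Oplus>k\<in>{..<n}. \<Oplus>l\<in>{..<n}. A $$ (i, k) \<otimes> (B $$ (k, l) \<otimes> C $$ (l, j)))"
    using ij mem by (intro finsum_swap) auto
  also have "\<dots> = (\<Oplus>k\<in>{..<n}. A $$ (i, k) \<otimes> (\<Oplus>l\<in>{..<n}. B $$ (k, l) \<otimes> C $$ (l, j)))"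
    using ij mem
    by (intro finsum_cong') (auto simp: finsum_rdistr intro!: finsum_closed finsum_cong')
  also have "\<dots> = (A \<otimes>\<^bsub>matrix_ring R n\<^esub> (B \<otimes>\<^bsub>matrix_ring R n\<^esub> C)) $$ (i, j)"
    using ij mem by (simp only: matrix_ring_entries, intro finsum_cong')
       (auto simp: matrix_ring_entries intro!: finsum_closed)
  finally show "((A \<otimes>\<^bsub>matrix_ring R n\<^esub> B) \<otimes>\<^bsub>matrix_ring R n\<^esub> C) $$ (i, j)
      = (A \<otimes>\<^bsub>matrix_ring R n\<^esub> (B \<otimes>\<^bsub>matrix_ring R n\<^esub> C)) $$ (i, j)" .
qed (use assms in \<open>auto intro!: matrix_ring_mult_closed\<close>)

lemma matrix_ring_abelian_group: "abelian_group (matrix_ring R n)"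
proof (rule abelian_groupI)
  fix A assume A: "A \<in> carrier (matrix_ring R n)"
  let ?N = "mat n n (\<lambda>(i, j). \<ominus> A $$ (i, j))"
  have "?N \<in> carrier (matrix_ring R n)"
    using A by (auto simp: matrix_ring_def)
  moreover have "?N \<oplus>\<^bsub>matrix_ring R n\<^esub> A = \<zero>\<^bsub>matrix_ring R n\<^esub>"
    using A by (intro eq_matI) (auto simp: matrix_ring_def l_neg)
  ultimately show "\<exists>B\<in>carrier (matrix_ring R n). B \<oplus>\<^bsub>matrix_ring R n\<^esub> A = \<zero>\<^bsub>matrix_ring R n\<^esub>"
    by blast
qed (auto simp: matrix_ring_def a_ac intro!: eq_matI)

lemma matrix_ring_is_ring: "ring (matrix_ring R n)"
proof (rule ringI)
  show "abelian_group (matrix_ring R n)"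
    by (rule matrix_ring_abelian_group)
  show "monoid (matrix_ring R n)"
  proof (rule monoidI)
    fix A assume A: "A \<in> carrier (matrix_ring R n)"
    show "\<one>\<^bsub>matrix_ring R n\<^esub> \<otimes>\<^bsub>matrix_ring R n\<^esub> A = A"
      using A by (intro matrix_ring_eqI)
        (auto simp: matrix_ring_one_eq scalar_matrix_mult_entry matrix_ring_entry_closed
          intro!: matrix_ring_mult_closed scalar_matrix_closed)
  qed (auto simp: matrix_ring_one_eq matrix_ring_r_one[unfolded matrix_ring_one_eq] matrix_ring_m_assoc
         intro: matrix_ring_mult_closed scalar_matrix_closed)
next
  fix A B C
  assume ABC: "A \<in> carrier (matrix_ring R n)" "B \<in> carrier (matrix_ring R n)"
    "C \<in> carrier (matrix_ring R n)"
  note mem = ABC[THEN matrix_ring_entry_closed]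
  show "(A \<oplus>\<^bsub>matrix_ring R n\<^esub> B) \<otimes>\<^bsub>matrix_ring R n\<^esub> C
      = A \<otimes>\<^bsub>matrix_ring R n\<^esub> C \<oplus>\<^bsub>matrix_ring R n\<^esub> B \<otimes>\<^bsub>matrix_ring R n\<^esub> C"
  proof (rule matrix_ring_eqI)
    fix i j assume ij: "i < n" "j < n"
    have "((A \<oplus>\<^bsub>matrix_ring R n\<^esub> B) \<otimes>\<^bsub>matrix_ring R n\<^esub> C) $$ (i, j)
        = (\<Oplus>k\<in>{..<n}. A $$ (i, k) \<otimes> C $$ (k, j) \<oplus> B $$ (i, k) \<otimes> C $$ (k, j))"
      using ij mem by (simp only: matrix_ring_entries, intro finsum_cong')
        (auto simp: matrix_ring_entries l_distr)
    also have "\<dots> = (A \<otimes>\<^bsub>matrix_ring R n\<^esub> C \<oplus>\<^bsub>matrix_ring R n\<^esub> B \<otimes>\<^bsub>matrix_ring R n\<^esub> C) $$ (i, j)"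
      using ij mem by (simp only: matrix_ring_entries, intro finsum_addf) auto
    finally show "((A \<oplus>\<^bsub>matrix_ring R n\<^esub> B) \<otimes>\<^bsub>matrix_ring R n\<^esub> C) $$ (i, j)
        = (A \<otimes>\<^bsub>matrix_ring R n\<^esub> C \<oplus>\<^bsub>matrix_ring R n\<^esub> B \<otimes>\<^bsub>matrix_ring R n\<^esub> C) $$ (i, j)" .
  qed (use ABC in \<open>auto intro!: matrix_ring_mult_closed matrix_ring_add_closed\<close>)
  show "C \<otimes>\<^bsub>matrix_ring R n\<^esub> (A \<oplus>\<^bsub>matrix_ring R n\<^esub> B)
      = C \<otimes>\<^bsub>matrix_ring R n\<^esub> A \<oplus>\<^bsub>matrix_ring R n\<^esub> C \<otimes>\<^bsub>matrix_ring R n\<^esub> B"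
  proof (rule matrix_ring_eqI)
    fix i j assume ij: "i < n" "j < n"
    have "(C \<otimes>\<^bsub>matrix_ring R n\<^esub> (A \<oplus>\<^bsub>matrix_ring R n\<^esub> B)) $$ (i, j)
        = (\<Oplus>k\<in>{..<n}. C $$ (i, k) \<otimes> A $$ (k, j) \<oplus> C $$ (i, k) \<otimes> B $$ (k, j))"
      using ij mem by (simp only: matrix_ring_entries, intro finsum_cong')
        (auto simp: matrix_ring_entries r_distr)
    also have "\<dots> = (C \<otimes>\<^bsub>matrix_ring R n\<^esub> A \<oplus>\<^bsub>matrix_ring R n\<^esub> C \<otimes>\<^bsub>matrix_ring R n\<^esub> B) $$ (i, j)"
      using ij mem by (simp only: matrix_ring_entries, intro finsum_addf) auto
    finally show "(C \<otimes>\<^bsub>matrix_ring R n\<^esub> (A \<oplus>\<^bsub>matrix_ring R n\<^esub> B)) $$ (i, j)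
        = (C \<otimes>\<^bsub>matrix_ring R n\<^esub> A \<oplus>\<^bsub>matrix_ring R n\<^esub> C \<otimes>\<^bsub>matrix_ring R n\<^esub> B) $$ (i, j)" .
  qed (use ABC in \<open>auto intro!: matrix_ring_mult_closed matrix_ring_add_closed\<close>)
qed

lemma entry_abelian_group_hom:
  assumes "i < n" "j < n"
  shows "abelian_group_hom (matrix_ring R n) R (\<lambda>A. A $$ (i, j))"
proof (intro abelian_group_hom.intro abelian_group_hom_axioms.intro group_hom.intro
    group_hom_axioms.intro)
  show "(\<lambda>A. A $$ (i, j)) \<in> hom (add_monoid (matrix_ring R n)) (add_monoid R)"
    using assms by (auto simp: hom_def matrix_ring_entries matrix_ring_entry_closed)
qed (use matrix_ring_abelian_group abelian_group.a_group abelian_group_axioms in blast)+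

end

section \<open>Ascending chains of submodules\<close>

text \<open>
  Left modules are given here by coordinates: an abelian group \<open>M\<close>, an operation \<open>act\<close> of the
  ring, and \<open>R\<close>-linear maps \<open>\<phi> 0, \<dots>, \<phi> (m - 1)\<close> from \<open>M\<close> to \<open>R\<close> that are jointly injective and
  so embed \<open>M\<close> into \<open>R\<^sup>m\<close>.  In this form the result applies to matrices through their entries,
  without an isomorphism to a model of \<open>R\<^sup>m\<close>.
\<close>

context left_noetherian_ring
begin

text \<open>
  The elements of \<open>V\<close> whose first \<open>e\<close> coordinates vanish form again a submodule, and \<open>\<phi> e\<close> maps it
  \<open>R\<close>-linearly to \<open>R\<close>.
\<close>

lemma leading_coefficients_left_ideal:
  fixes e :: nat
  assumes hom: "\<And>i. i \<le> e \<Longrightarrow> abelian_group_hom M R (\<phi> i)"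
    and act: "\<And>i r x. i \<le> e \<Longrightarrow> r \<in> carrier R \<Longrightarrow> x \<in> carrier M \<Longrightarrow> \<phi> i (act r x) = r \<otimes> \<phi> i x"
    and V: "additive_subgroup V M" "\<And>r x. r \<in> carrier R \<Longrightarrow> x \<in> V \<Longrightarrow> act r x \<in> V"
  shows "left_ideal (\<phi> e ` {x \<in> V. \<forall>i<e. \<phi> i x = \<zero>}) R" (is "left_ideal (\<phi> e ` ?W) R")
proof -
  interpret V: additive_subgroup V M by (rule V(1))
  interpret h: abelian_group_hom M R "\<phi> e" by (rule hom) simp
  have low_hom: "abelian_group_hom M R (\<phi> i)" if "i < e" for i
    using that by (intro hom) simp
  note low_add = abelian_group_hom.hom_add[OF low_hom]
    and low_zero = abelian_group_hom.hom_zero[OF low_hom]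
    and low_minus = abelian_group_hom.hom_a_inv[OF low_hom]
  have "subgroup ?W (add_monoid M)"
  proof (rule h.G.add.subgroupI)
    show "?W \<subseteq> carrier M" using V.a_subset by blast
    have "\<zero>\<^bsub>M\<^esub> \<in> ?W" by (simp add: low_zero)
    then show "?W \<noteq> {}" by (metis empty_iff)
  next
    fix x assume "x \<in> ?W"
    then show "\<ominus>\<^bsub>M\<^esub> x \<in> ?W" by (simp add: low_minus)
  next
    fix x y assume "x \<in> ?W" "y \<in> ?W"
    then show "x \<oplus>\<^bsub>M\<^esub> y \<in> ?W" by (simp add: low_add)
  qed
  then have "subgroup (\<phi> e ` ?W) (add_monoid R)"
    by (rule group_hom.subgroup_img_is_subgroup[OF h.a_group_hom])
  moreover have "r \<otimes> y \<in> \<phi> e ` ?W" if r: "r \<in> carrier R" and y: "y \<in> \<phi> e ` ?W" for r y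
  proof -
    obtain x where x: "x \<in> ?W" "y = \<phi> e x" using y by blast
    have xM: "x \<in> carrier M" using x(1) by simp
    have act_x: "\<phi> i (act r x) = r \<otimes> \<phi> i x" if "i \<le> e" for i
      using that r xM by (rule act)
    then have "act r x \<in> ?W"
      using x(1) V(2)[OF r] r by (simp add: less_imp_le)
    moreover have "r \<otimes> y = \<phi> e (act r x)" using act_x[of e] x(2) by simp
    ultimately show ?thesis by (rule rev_image_eqI)
  qed
  ultimately show ?thesis unfolding left_ideal_def additive_subgroup_def by blast
qed

text \<open>
  The chain stops at the latest when the leading ideals of all \<open>m\<close> coordinates have stopped growing.
\<close>

lemma submodule_chain_stabilizes:
  fixes m :: nat
  assumes hom: "\<And>e. e < m \<Longrightarrow> abelian_group_hom M R (\<phi> e)"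
    and act: "\<And>e r x. e < m \<Longrightarrow> r \<in> carrier R \<Longrightarrow> x \<in> carrier M \<Longrightarrow> \<phi> e (act r x) = r \<otimes> \<phi> e x"
    and inj: "\<And>x. x \<in> carrier M \<Longrightarrow> (\<And>e. e < m \<Longrightarrow> \<phi> e x = \<zero>) \<Longrightarrow> x = \<zero>\<^bsub>M\<^esub>"
    and M: "abelian_group M"
    and V: "\<And>k. additive_subgroup (V k) M"
    and V_act: "\<And>k r x. r \<in> carrier R \<Longrightarrow> x \<in> V k \<Longrightarrow> act r x \<in> V k"
    and chain: "\<And>k. V k \<subseteq> V (Suc k)"
  shows "\<exists>N. \<forall>k\<ge>N. V k = V N"
proof -
  interpret M: abelian_group M by (rule M)
  define J where "J e k = \<phi> e ` {x \<in> V k. \<forall>i<e. \<phi> i x = \<zero>}" for e k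
  have "\<exists>N. \<forall>k\<ge>N. J e k = J e N" if "e < m" for e
  proof (rule left_ideal_chain_stabilizes)
    show "left_ideal (J e k) R" for k
      unfolding J_def using that
      by (intro leading_coefficients_left_ideal[where M = M and act = act] hom act V V_act) auto
    show "J e k \<subseteq> J e (Suc k)" for k
      unfolding J_def using chain by blast
  qed
  then obtain N where N: "\<And>e k. e < m \<Longrightarrow> k \<ge> N e \<Longrightarrow> J e k = J e (N e)"
    by metis
  define L where "L = Max (insert 0 (N ` {..<m}))"
  have "N e \<le> L" if "e < m" for e
    unfolding L_def using that by (intro Max_ge) auto
  then have J_L: "J e k = J e L" if "e < m" "k \<ge> L" for e k
    using N[of e k] N[of e L] that le_trans by metis
  have mono: "V L \<subseteq> V k" if "k \<ge> L" for k
    using lift_Suc_mono_le[of V, OF chain that] .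
  \<comment> \<open>Induction downwards on the number \<open>e\<close> of vanishing coordinates: for \<open>e = m\<close> the element is
    zero, and for \<open>e < m\<close> its leading coefficient is that of some \<open>y \<in> V L\<close>, so that subtracting
    \<open>y\<close> makes one more coordinate vanish.\<close>
  have "x \<in> V L" if "k \<ge> L" "x \<in> V k" "e \<le> m" "\<And>i. i < e \<Longrightarrow> \<phi> i x = \<zero>" for k x e
    using that(3,2,4)
  proof (induction e arbitrary: x rule: inc_induct)
    case base
    interpret Vk: additive_subgroup "V k" M by (rule V)
    interpret VL: additive_subgroup "V L" M by (rule V)
    have "x = \<zero>\<^bsub>M\<^esub>" using base by (intro inj) auto
    then show ?case by simp
  next
    case (step e)
    interpret Vk: additive_subgroup "V k" M by (rule V)
    interpret VL: additive_subgroup "V L" M by (rule V)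
    have "\<phi> e x \<in> J e L"
      using J_L[of e k] step that(1) by (auto simp: J_def)
    then obtain y where y: "y \<in> V L" "\<And>i. i < e \<Longrightarrow> \<phi> i y = \<zero>" "\<phi> e y = \<phi> e x"
      by (auto simp: J_def)
    have yk: "y \<in> V k" using y(1) mono that(1) by blast
    have xM: "x \<in> carrier M" and yM: "y \<in> carrier M" using yk step.prems by auto
    have "x \<oplus>\<^bsub>M\<^esub> \<ominus>\<^bsub>M\<^esub> y \<in> V L"
    proof (rule step.IH)
      show "x \<oplus>\<^bsub>M\<^esub> \<ominus>\<^bsub>M\<^esub> y \<in> V k" using step.prems yk by auto
      fix i assume i: "i < Suc e"
      interpret hi: abelian_group_hom M R "\<phi> i" using i step.hyps by (intro hom) simp
      have "\<phi> i y = \<phi> i x" using i y step.prems by (cases "i = e") auto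
      then show "\<phi> i (x \<oplus>\<^bsub>M\<^esub> \<ominus>\<^bsub>M\<^esub> y) = \<zero>"
        using xM yM r_neg[of "\<phi> i x"] hi.hom_closed[OF xM] by simp
    qed
    then have "(x \<oplus>\<^bsub>M\<^esub> \<ominus>\<^bsub>M\<^esub> y) \<oplus>\<^bsub>M\<^esub> y \<in> V L" using y(1) by (rule VL.a_closed)
    then show ?case using xM yM by (simp add: M.a_assoc M.l_neg)
  qed
  then have "V k \<subseteq> V L" if "k \<ge> L" for k
    using that by (meson le0 not_less0 subsetI)
  with mono show ?thesis by (intro exI[of _ L] allI impI subset_antisym) auto
qed

text \<open>
  The \<open>n\<^sup>2\<close> entries, numbered row by row, are coordinates of \<open>M\<^sub>n(R)\<close> as a left module.
\<close>

lemma matrix_submodule_chain_stabilizes: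
  assumes V: "\<And>k. additive_subgroup (V k) (matrix_ring R n)"
    and V_scalar: "\<And>k r A. r \<in> carrier R \<Longrightarrow> A \<in> V k \<Longrightarrow>
          scalar_matrix R n r \<otimes>\<^bsub>matrix_ring R n\<^esub> A \<in> V k"
    and chain: "\<And>k. V k \<subseteq> V (Suc k)"
  shows "\<exists>N. \<forall>k\<ge>N. V k = V N"
proof (rule submodule_chain_stabilizes[where M = "matrix_ring R n" and m = "n * n"
      and \<phi> = "\<lambda>e A. A $$ (e div n, e mod n)"
      and act = "\<lambda>r A. scalar_matrix R n r \<otimes>\<^bsub>matrix_ring R n\<^esub> A"])
  have idx: "e div n < n" "e mod n < n" if "e < n * n" for e
    using that by (auto simp: less_mult_imp_div_less intro!: mod_less_divisor gr0I)
  show "abelian_group_hom (matrix_ring R n) R (\<lambda>A. A $$ (e div n, e mod n))" if "e < n * n" for e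
    using idx[OF that] by (rule entry_abelian_group_hom)
  show "(scalar_matrix R n r \<otimes>\<^bsub>matrix_ring R n\<^esub> A) $$ (e div n, e mod n)
      = r \<otimes> A $$ (e div n, e mod n)"
    if "e < n * n" "r \<in> carrier R" "A \<in> carrier (matrix_ring R n)" for e r A
    using that idx by (intro scalar_matrix_mult_entry) auto
  show "A = \<zero>\<^bsub>matrix_ring R n\<^esub>"
    if A: "A \<in> carrier (matrix_ring R n)"
      and zero: "\<And>e. e < n * n \<Longrightarrow> A $$ (e div n, e mod n) = \<zero>" for A
  proof (rule matrix_ring_eqI[OF A])
    show "\<zero>\<^bsub>matrix_ring R n\<^esub> \<in> carrier (matrix_ring R n)"
      by (rule ring.ring_simprules(2)[OF matrix_ring_is_ring])
    fix i j assume ij: "i < n" "j < n"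
    have "i * n + j < Suc i * n" using ij by simp
    also have "\<dots> \<le> n * n" using ij by (intro mult_right_mono) auto
    finally show "A $$ (i, j) = \<zero>\<^bsub>matrix_ring R n\<^esub> $$ (i, j)"
      using zero[of "i * n + j"] ij by (simp add: matrix_ring_entries)
  qed
qed (use matrix_ring_abelian_group V V_scalar chain in auto)

end

section \<open>Units of a subring\<close>

lemma (in monoid) Units_submonoid_subset:
  assumes "submonoid S G"
  shows "Units (G\<lparr>carrier := S\<rparr>) \<subseteq> S \<inter> Units G"
  using submonoid.subset[OF assms] by (auto simp: Units_def)

text \<open>Inserting \<open>a \<otimes> inv a\<close> after \<open>s\<close> absorbs \<open>a\<close> into \<open>S\<close> and leaves one more \<open>inv a\<close>.\<close>

lemma (in monoid) translates_by_inverse_powers_ascending: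
  assumes S: "submonoid S G" and a: "a \<in> S" "a \<in> Units G"
  shows "(\<lambda>s. s \<otimes> inv a [^] (k::nat)) ` S \<subseteq> (\<lambda>s. s \<otimes> inv a [^] Suc k) ` S"
proof (rule image_subsetI)
  fix s assume s: "s \<in> S"
  have sG: "s \<in> carrier G" using s submonoid.subset[OF S] by blast
  have "inv a [^] Suc k = inv a \<otimes> inv a [^] k"
    using a(2) by (intro nat_pow_Suc2) simp
  then have "(s \<otimes> a) \<otimes> inv a [^] Suc k = s \<otimes> ((a \<otimes> inv a) \<otimes> inv a [^] k)"
    using sG a(2) by (simp add: m_assoc Units_closed del: nat_pow_Suc Group.nat_pow_Suc Units_r_inv)
  also have "\<dots> = s \<otimes> inv a [^] k"
    using a(2) by simp
  finally show "s \<otimes> inv a [^] k \<in> (\<lambda>s. s \<otimes> inv a [^] Suc k) ` S"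
    using submonoid.m_closed[OF S s a(1)] by (metis imageI)
qed

text \<open>
  Since \<open>\<one> \<in> S\<close>, stabilization puts the power \<open>inv a [^] Suc k\<close> itself into the \<open>k\<close>-th translate,
  and units can be cancelled.
\<close>

lemma (in monoid) inv_mem_submonoid_if_translates_stabilize:
  assumes S: "submonoid S G" and a: "a \<in> Units G"
    and stable: "(\<lambda>s. s \<otimes> inv a [^] Suc k) ` S = (\<lambda>s. s \<otimes> inv a [^] (k::nat)) ` S"
  shows "inv a \<in> S"
proof -
  have "inv a [^] Suc k \<in> (\<lambda>s. s \<otimes> inv a [^] Suc k) ` S"
    by (rule image_eqI[OF _ submonoid.one_closed[OF S]]) (use a in simp)
  then obtain s where s: "s \<in> S" "inv a [^] Suc k = s \<otimes> inv a [^] k"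
    unfolding stable by blast
  have sG: "s \<in> carrier G" using s submonoid.subset[OF S] by blast
  have cancel: "inv a [^] k \<otimes> a [^] k = \<one>"
    using pow_mult_distrib[of "inv a" a k] a by (simp add: Units_closed)
  have "inv a [^] Suc k = inv a \<otimes> inv a [^] k"
    using a by (intro nat_pow_Suc2) simp
  then have "inv a = inv a [^] Suc k \<otimes> a [^] k"
    using a cancel by (simp add: m_assoc Units_closed del: nat_pow_Suc Group.nat_pow_Suc)
  also have "\<dots> = s"
    using a sG cancel unfolding s(2) by (simp add: m_assoc Units_closed)
  finally show ?thesis using s(1) by simp
qed

lemma (in ring) translate_additive_subgroup:
  assumes "additive_subgroup S R" "x \<in> carrier R"
  shows "additive_subgroup ((\<lambda>s. s \<otimes> x) ` S) R"
proof -
  have "(\<lambda>s. s \<otimes> x) \<in> hom (add_monoid R) (add_monoid R)"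
    using assms(2) by (auto simp: hom_def l_distr)
  then have "group_hom (add_monoid R) (add_monoid R) (\<lambda>s. s \<otimes> x)"
    by (intro group_hom.intro group_hom_axioms.intro a_group)
  with assms(1) show ?thesis
    unfolding additive_subgroup_def by (intro group_hom.subgroup_img_is_subgroup)
qed

theorem theorem2p6:
  fixes R :: "('a, 'b) ring_scheme" and n :: nat and S :: "'a mat set"
  assumes "left_noetherian_ring R"
    and "n \<ge> 1"
    and "subring S (matrix_ring R n)"
    and "{scalar_matrix R n r | r. r \<in> carrier R} \<subseteq> S"
  shows "S \<inter> Units (matrix_ring R n) = Units ((matrix_ring R n)\<lparr>carrier := S\<rparr>)"
proof (rule subset_antisym)
  interpret left_noetherian_ring R by (rule assms(1))
  interpret M: ring "matrix_ring R n" by (rule matrix_ring_is_ring)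
  interpret S: subring S "matrix_ring R n" by (rule assms(3))
  show "Units ((matrix_ring R n)\<lparr>carrier := S\<rparr>) \<subseteq> S \<inter> Units (matrix_ring R n)"
    by (rule M.Units_submonoid_subset) (rule S.submonoid_axioms)
  show "S \<inter> Units (matrix_ring R n) \<subseteq> Units ((matrix_ring R n)\<lparr>carrier := S\<rparr>)"
  proof
    fix A assume "A \<in> S \<inter> Units (matrix_ring R n)"
    then have AS: "A \<in> S" and AU: "A \<in> Units (matrix_ring R n)" by auto
    define B where "B = inv\<^bsub>matrix_ring R n\<^esub> A"
    have BM: "B \<in> carrier (matrix_ring R n)" using AU by (simp add: B_def)
    define V where
      "V k = (\<lambda>s. s \<otimes>\<^bsub>matrix_ring R n\<^esub> B [^]\<^bsub>matrix_ring R n\<^esub> k) ` S" for k :: nat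
    have "\<exists>N. \<forall>k\<ge>N. V k = V N"
    proof (rule matrix_submodule_chain_stabilizes)
      show "additive_subgroup (V k) (matrix_ring R n)" for k
        unfolding V_def using BM
        by (intro M.translate_additive_subgroup additive_subgroupI S.subgroup_axioms) simp
      show "scalar_matrix R n r \<otimes>\<^bsub>matrix_ring R n\<^esub> X \<in> V k"
        if r: "r \<in> carrier R" and X: "X \<in> V k" for k r X
      proof -
        obtain s where s: "s \<in> S" "X = s \<otimes>\<^bsub>matrix_ring R n\<^esub> B [^]\<^bsub>matrix_ring R n\<^esub> k"
          using X by (auto simp: V_def)
        have rS: "scalar_matrix R n r \<in> S" using r assms(4) by blast
        have "scalar_matrix R n r \<otimes>\<^bsub>matrix_ring R n\<^esub> X
            = (scalar_matrix R n r \<otimes>\<^bsub>matrix_ring R n\<^esub> s) \<otimes>\<^bsub>matrix_ring R n\<^esub> B [^]\<^bsub>matrix_ring R n\<^esub> k"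
          using s rS BM subringE(1)[OF assms(3)] by (simp add: M.m_assoc subset_iff)
        then show ?thesis
          using subringE(6)[OF assms(3) rS s(1)] by (auto simp: V_def)
      qed
      show "V k \<subseteq> V (Suc k)" for k
        unfolding V_def B_def
        by (rule M.translates_by_inverse_powers_ascending[OF S.submonoid_axioms AS AU])
    qed
    then obtain N where "V (Suc N) = V N" by (metis le_SucI order_refl)
    then have "B \<in> S"
      unfolding V_def B_def
      by (rule M.inv_mem_submonoid_if_translates_stabilize[OF S.submonoid_axioms AU])
    then show "A \<in> Units ((matrix_ring R n)\<lparr>carrier := S\<rparr>)"
      using AS M.Units_l_inv[OF AU] M.Units_r_inv[OF AU]
      unfolding Units_def B_def by (intro CollectI) (simp, blast)
  qed
qed

end
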